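(* Let $h\colon\mathcal{X}\to\mathcal{Y}$ be a classifier with conditional risk $r(x)=\sum_{y\in\mathcal{Y}}p(y\mid x)\,\ell(y,h(x))$, let $n\ge 2$, and let $E_{\rm sele}(s)$ be the expectation of the SELE loss $\Delta_{\rm sele}(s,\mathcal{T}_n)$ over $n$ i.i.d. examples from $p(x,y)$. A function $s^*\colon\mathcal{X}\to\mathbb{R}$ is an optimal solution to $\min_{s\colon\mathcal{X}\to\mathbb{R}}E_{\rm sele}(s)$ if and only if $$\int_{\mathcal{X}}\int_{\substack{z\neq x\\ s^*(z)=s^*(x)}}\max\{r(x),r(z)\}\,p(x)p(z)\,dz\,dx=0$$ and $$\int_{\mathcal{X}}\int_{\substack{r(z)<r(x)\\ s^*(z)>s^*(x)}}\big(r(x)-r(z)\big)\,p(x)p(z)\,dz\,dx=0 .$$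
   Context: $\mathcal{X}$ is a set of inputs (a measurable space with a fixed reference measure $dx$), $\mathcal{Y}$ is a finite set of labels, $p(x,y)$ is a probability density on $\mathcal{X}\times\mathcal{Y}$ (with respect to $dx$ times counting measure), $p(x)=\sum_{y\in\mathcal{Y}}p(x,y)$ is its marginal, and $p(y\mid x)$ is the conditional distribution, so $p(x,y)=p(x)p(y\mid x)$. $\ell\colon\mathcal{Y}\times\mathcal{Y}\to[0,\infty)$ is a loss. All functions and sets involved (including the diagonal of $\mathcal{X}\times\mathcal{X}$) are taken measurable. For $\mathcal{T}_n=\{(x_i,y_i)\mid i=1,\ldots,n\}$ the SELE loss is $$\Delta_{\rm sele}(s,\mathcal{T}_n)=\frac1{n^2}\sum_{i=1}^n\sum_{j=1}^n\ell(y_i,h(x_i))\,[\![ s(x_i)\le s(x_j)]\!],$$ where $[\![ A]\!]$ is $1$ if $A$ holds and $0$ otherwise, and $$E_{\rm sele}(s)=\int_{\mathcal{X}^n}\sum_{(y_1,\ldots,y_n)\in\mathcal{Y}^n}\prod_{i=1}^n p(x_i,y_i)\,\Delta_{\rm sele}(s,\mathcal{T}_n)\,dx_1\cdots dx_n .$$ A double integral with conditions written under the inner integral sign, $\int_{\mathcal{X}}\int_{\varphi_1(x,z),\,\varphi_2(x,z)}f(x,z)\,dz\,dx$, means $\int_{\mathcal{X}}\int_{\mathcal{X}}f(x,z)\,[\![\varphi_1(x,z)\wedge\varphi_2(x,z)]\!]\,dz\,dx$. *)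

theory Defs
  imports "HOL-Probability.Probability"
begin

definition marginal :: "('x \<times> 'y::finite \<Rightarrow> real) \<Rightarrow> 'x \<Rightarrow> real" where
  "marginal p x = (\<Sum>y\<in>UNIV. p (x, y))"

text \<open>Where the marginal vanishes the factorisation does not determine \<open>q\<close>, so \<open>q\<close> is an
  arbitrary version of the conditional distribution, with \<open>q x y\<close> standing for \<open>p(y | x)\<close>.\<close>

definition cond_distribution ::
    "'x measure \<Rightarrow> ('x \<times> 'y::finite \<Rightarrow> real) \<Rightarrow> ('x \<Rightarrow> 'y \<Rightarrow> real) \<Rightarrow> bool" where
  "cond_distribution M p q \<longleftrightarrow>
     (\<forall>y. (\<lambda>x. q x y) \<in> borel_measurable M) \<and>
     (\<forall>x\<in>space M. (\<forall>y. 0 \<le> q x y) \<and> (\<Sum>y\<in>UNIV. q x y) = 1 \<and>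
                  (\<forall>y. p (x, y) = marginal p x * q x y))"

definition cond_risk ::
    "('x \<Rightarrow> 'y::finite \<Rightarrow> real) \<Rightarrow> ('y \<Rightarrow> 'y \<Rightarrow> real) \<Rightarrow> ('x \<Rightarrow> 'y) \<Rightarrow> 'x \<Rightarrow> real" where
  "cond_risk q l h x = (\<Sum>y\<in>UNIV. q x y * l y (h x))"

definition sele_loss ::
    "('y \<Rightarrow> 'y \<Rightarrow> real) \<Rightarrow> ('x \<Rightarrow> 'y) \<Rightarrow> nat \<Rightarrow> ('x \<Rightarrow> real) \<Rightarrow> (nat \<Rightarrow> 'x \<times> 'y) \<Rightarrow> real" where
  "sele_loss l h n s T =
     1 / (real n)\<^sup>2 *
       (\<Sum>i=1..n. \<Sum>j=1..n. l (snd (T i)) (h (fst (T i))) * of_bool (s (fst (T i)) \<le> s (fst (T j))))"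

definition E_sele ::
    "'x measure \<Rightarrow> ('x \<times> 'y::finite \<Rightarrow> real) \<Rightarrow> ('y \<Rightarrow> 'y \<Rightarrow> real) \<Rightarrow> ('x \<Rightarrow> 'y) \<Rightarrow> nat \<Rightarrow>
      ('x \<Rightarrow> real) \<Rightarrow> real" where
  "E_sele M p l h n s =
     (LINT x|PiM {1..n} (\<lambda>_. M).
        (\<Sum>y\<in>PiE {1..n} (\<lambda>_. UNIV). (\<Prod>i=1..n. p (x i, y i)) * sele_loss l h n s (\<lambda>i. (x i, y i))))"

end

theory Submission
  imports Defs
begin

text \<open>Let \<open>N\<close> be the probability measure with density \<open>p(x)\<close>. The terms of the SELE loss with
  \<open>i \<noteq> j\<close> all have the same expectation, that of \<open>r(x) [s(x) \<le> s(z)]\<close> under \<open>N \<Otimes> N\<close>, and those with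
  \<open>i = j\<close> do not depend on \<open>s\<close>. Averaging over the exchange of \<open>x\<close> and \<open>z\<close> and comparing with
  \<open>min {r(x), r(z)}\<close> shows that \<open>E_sele(s)\<close> is an increasing affine function of \<open>A(s) + 2 B(s)\<close>, where
  \<open>A(s), B(s) \<ge> 0\<close> are the two integrals of the theorem. It remains to see that \<open>A + 2 B\<close> has infimum
  \<open>0\<close>. As the diagonal is measurable, countably many measurable sets separate the points, so there is
  an injective measurable \<open>f\<close> with values in \<open>[0, 1)\<close>, and \<open>s = \<lfloor>k r\<rfloor> + f\<close> has \<open>A(s) = 0\<close> and
  \<open>B(s) \<le> 1 / k\<close>.\<close>

section \<open>Countable separation of points and an injective measurable function\<close>

text \<open>By induction on the generation of the product sigma-algebra: a rectangle is decided by
  its own sides, a complement by the same family, a countable union by the union of the families.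
  Applied to the diagonal, this yields countably many sets that separate points.\<close>

lemma sigma_sets_pair_countable_separation:
  assumes "D \<in> sets (M \<Otimes>\<^sub>M N)"
  shows "\<exists>C. countable C \<and> C \<subseteq> sets M \<times> sets N \<and>
    (\<forall>x\<in>space M. \<forall>x'\<in>space M. \<forall>y\<in>space N. \<forall>y'\<in>space N.
       (\<forall>(A, B)\<in>C. (x \<in> A \<longleftrightarrow> x' \<in> A) \<and> (y \<in> B \<longleftrightarrow> y' \<in> B)) \<longrightarrow>
       ((x, y) \<in> D \<longleftrightarrow> (x', y') \<in> D))"
proof -
  define P where "P C D \<longleftrightarrow> countable C \<and> C \<subseteq> sets M \<times> sets N \<and>
    (\<forall>x\<in>space M. \<forall>x'\<in>space M. \<forall>y\<in>space N. \<forall>y'\<in>space N.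
       (\<forall>(A, B)\<in>C. (x \<in> A \<longleftrightarrow> x' \<in> A) \<and> (y \<in> B \<longleftrightarrow> y' \<in> B)) \<longrightarrow>
       ((x, y) \<in> D \<longleftrightarrow> (x', y') \<in> D))" for C D
  have "D \<in> sigma_sets (space M \<times> space N) {a \<times> b | a b. a \<in> sets M \<and> b \<in> sets N}"
    using assms by (simp add: sets_pair_measure)
  then have "\<exists>C. P C D"
  proof induction
    case (Basic D)
    then obtain A B where "D = A \<times> B" "A \<in> sets M" "B \<in> sets N" by auto
    then show ?case by (intro exI[of _ "{(A, B)}"]) (auto simp: P_def)
  next
    case Empty
    then show ?case by (intro exI[of _ "{}"]) (auto simp: P_def)
  next
    case (Compl D)
    then obtain C where C: "P C D" by auto
    have "P C (space M \<times> space N - D)"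
      unfolding P_def
    proof (intro conjI ballI impI)
      fix x x' y y'
      assume *: "x\<in>space M" "x'\<in>space M" "y\<in>space N" "y'\<in>space N"
        "\<forall>(A, B)\<in>C. (x \<in> A \<longleftrightarrow> x' \<in> A) \<and> (y \<in> B \<longleftrightarrow> y' \<in> B)"
      have "(x, y) \<in> D \<longleftrightarrow> (x', y') \<in> D"
        using C[unfolded P_def, THEN conjunct2, THEN conjunct2,
            THEN bspec, OF *(1), THEN bspec, OF *(2), THEN bspec, OF *(3), THEN bspec, OF *(4)] *(5)
        by (rule mp)
      then show "(x, y) \<in> space M \<times> space N - D \<longleftrightarrow> (x', y') \<in> space M \<times> space N - D"
        using *(1-4) by simp
    qed (use C in \<open>simp_all add: P_def\<close>)
    then show ?case ..
  next
    case (Union D)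
    then have "\<forall>i. \<exists>C. P C (D i)" by simp
    then obtain C where C: "\<forall>i. P (C i) (D i)" using choice[of "\<lambda>i C. P C (D i)"] by auto
    have "P (\<Union>i. C i) (\<Union>i. D i)"
      unfolding P_def
    proof (intro conjI ballI impI)
      fix x x' y y'
      assume *: "x\<in>space M" "x'\<in>space M" "y\<in>space N" "y'\<in>space N"
        "\<forall>(A, B)\<in>(\<Union>i. C i). (x \<in> A \<longleftrightarrow> x' \<in> A) \<and> (y \<in> B \<longleftrightarrow> y' \<in> B)"
      have "(x, y) \<in> D i \<longleftrightarrow> (x', y') \<in> D i" for i
      proof -
        have "\<forall>(A, B)\<in>C i. (x \<in> A \<longleftrightarrow> x' \<in> A) \<and> (y \<in> B \<longleftrightarrow> y' \<in> B)"
          using *(5) by simp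
        with C[THEN spec, of i, unfolded P_def, THEN conjunct2, THEN conjunct2,
            THEN bspec, OF *(1), THEN bspec, OF *(2), THEN bspec, OF *(3), THEN bspec, OF *(4)]
        show ?thesis by (rule mp)
      qed
      then show "(x, y) \<in> (\<Union>i. D i) \<longleftrightarrow> (x', y') \<in> (\<Union>i. D i)" by simp
    next
      show "countable (\<Union>i. C i)" using C by (simp add: P_def)
      show "(\<Union>i. C i) \<subseteq> sets M \<times> sets N" using C unfolding P_def by blast
    qed
    then show ?case ..
  qed
  then show ?thesis unfolding P_def .
qed

text \<open>In base \<open>4\<close> the digits after the first difference cannot compensate for it.\<close>

lemma suminf_base4_inj:
  fixes a b :: "nat \<Rightarrow> bool"
  assumes eq: "(\<Sum>n. of_bool (a n) * (1/4)^Suc n) = (\<Sum>n. of_bool (b n) * (1/4)^Suc n :: real)"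
  shows "a = b"
proof (rule ccontr)
  have sm: "summable (\<lambda>n. of_bool (c n) * (1/4)^Suc n :: real)" for c
    by (rule summable_comparison_test'[of "\<lambda>n. (1/4)^n"]) (auto simp: summable_geometric)
  define d where "d n = (of_bool (a n) - of_bool (b n) :: real)" for n
  have smd: "summable (\<lambda>n. d n * (1/4)^Suc n)"
    using summable_diff[OF sm[of a] sm[of b]] by (simp only: d_def left_diff_distrib)
  have d0: "(\<Sum>n. d n * (1/4)^Suc n) = 0"
    using suminf_diff[OF sm[of a] sm[of b]] eq by (simp only: d_def left_diff_distrib)
  assume "a \<noteq> b"
  then have "\<exists>n. a n \<noteq> b n" by auto
  define m where "m = (LEAST n. a n \<noteq> b n)"
  have m: "a m \<noteq> b m" unfolding m_def using \<open>\<exists>n. a n \<noteq> b n\<close> by (rule LeastI_ex)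
  have "d n = 0" if "n < m" for n
    using not_less_Least[of n "\<lambda>n. a n \<noteq> b n"] that by (simp add: m_def d_def)
  then have "(\<Sum>n. d (n + m) * (1/4)^Suc (n + m)) = 0"
    using d0 suminf_split_initial_segment[OF smd, of m] by simp
  moreover have sm2: "summable (\<lambda>n. d (n + m) * (1/4)^Suc (n + m))"
    using smd by (rule summable_ignore_initial_segment)
  ultimately have "(\<Sum>n. d (n + Suc m) * (1/4)^Suc (n + Suc m)) = - (d m * (1/4)^Suc m)"
    using suminf_split_head[OF sm2] by simp
  \<comment> \<open>Digit differences are at most 1 in absolute value, so the tail is at most a
    third of the term at \<open>m\<close>, which it would have to cancel.\<close>
  moreover have "\<bar>\<Sum>n. d (n + Suc m) * (1/4)^Suc (n + Suc m)\<bar> \<le> (\<Sum>n. (1/4)^Suc (Suc m) * (1/4)^n)"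
    unfolding real_norm_def[symmetric]
    by (rule norm_suminf_le) (auto simp: d_def power_add abs_mult summable_geometric)
  moreover have "(\<Sum>n. (1/4)^Suc (Suc m) * (1/4)^n) = (1/4)^Suc (Suc m) * (4/3::real)"
    by (subst suminf_mult) (auto simp: summable_geometric suminf_geometric)
  moreover have "\<bar>d m * (1/4)^Suc m\<bar> = (1/4)^Suc m"
    using m by (auto simp: d_def)
  ultimately have "(1/4)^Suc m \<le> (1/4)^Suc (Suc m) * (4/3::real)" by linarith
  then show False by simp
qed

text \<open>Let \<open>C\<close> decide membership in the diagonal. Two points lying in the same
  sets of \<open>C\<close> cannot be told apart by the diagonal, hence are equal. Reading the
  memberships as base 4 digits packs the countable family into one real function.\<close>

lemma ex_inj_on_measurable:
  assumes diag: "{w \<in> space (M \<Otimes>\<^sub>M M). fst w = snd w} \<in> sets (M \<Otimes>\<^sub>M M)"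
  obtains f :: "'a \<Rightarrow> real"
  where "f \<in> borel_measurable M" "inj_on f (space M)" "\<And>x. 0 \<le> f x" "\<And>x. f x < 1"
proof -
  let ?D = "{w \<in> space (M \<Otimes>\<^sub>M M). fst w = snd w}"
  obtain C where C: "countable C" "C \<subseteq> sets M \<times> sets M" and
    sep: "\<forall>x\<in>space M. \<forall>x'\<in>space M. \<forall>y\<in>space M. \<forall>y'\<in>space M.
       (\<forall>(A, B)\<in>C. (x \<in> A \<longleftrightarrow> x' \<in> A) \<and> (y \<in> B \<longleftrightarrow> y' \<in> B)) \<longrightarrow>
       ((x, y) \<in> ?D \<longleftrightarrow> (x', y') \<in> ?D)"
    using sigma_sets_pair_countable_separation[OF diag] by (elim exE conjE)
  \<comment> \<open>Second components suffice, because the diagonal is only tested with the first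
    coordinate held fixed. The empty set makes \<open>S\<close> nonempty, so that it can be
    enumerated even if \<open>C\<close> is empty.\<close>
  define S where "S = insert {} (snd ` C)"
  have S: "countable S" "S \<noteq> {}" using C by (auto simp: S_def)
  define A where "A = from_nat_into S"
  have rA: "range A = S" unfolding A_def using S by (rule range_from_nat_into[rotated])
  have [measurable]: "A n \<in> sets M" for n
  proof -
    have "A n \<in> S" using rA by auto
    then show ?thesis using C by (auto simp: S_def)
  qed
  define f :: "'a \<Rightarrow> real" where "f x = (\<Sum>n. of_bool (x \<in> A n) * (1/4)^Suc n)" for x
  have sm: "summable (\<lambda>n. of_bool (x \<in> A n) * (1/4)^Suc n :: real)" for x
    by (rule summable_comparison_test'[of "\<lambda>n. (1/4)^n"]) (auto simp: summable_geometric)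
  show ?thesis
  proof
    show "f \<in> borel_measurable M" unfolding f_def by measurable
    show "inj_on f (space M)"
    proof
      fix x y assume xy: "x \<in> space M" "y \<in> space M" "f x = f y"
      then have "(\<lambda>n. x \<in> A n) = (\<lambda>n. y \<in> A n)"
        unfolding f_def by (intro suminf_base4_inj) auto
      then have "x \<in> B \<longleftrightarrow> y \<in> B" if "B \<in> S" for B
        using that unfolding rA[symmetric] by (auto dest: fun_cong)
      then have "x \<in> snd c \<longleftrightarrow> y \<in> snd c" if "c \<in> C" for c
        using that by (simp add: S_def)
      \<comment> \<open>The pairs \<open>(x, x)\<close> and \<open>(x, y)\<close> agree on every set
        of \<open>C\<close>, so with the first also the second lies on the diagonal.\<close>
      then have "\<forall>(A, B)\<in>C. (x \<in> A \<longleftrightarrow> x \<in> A) \<and> (x \<in> B \<longleftrightarrow> y \<in> B)"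
        by fastforce
      then have "(x, x) \<in> ?D \<longleftrightarrow> (x, y) \<in> ?D"
        using sep[THEN bspec, OF xy(1), THEN bspec, OF xy(1), THEN bspec, OF xy(1), THEN bspec, OF xy(2)]
        by (rule rev_mp)
      with xy show "x = y" by (simp add: space_pair_measure)
    qed
    show "0 \<le> f x" for x unfolding f_def by (intro suminf_nonneg sm) auto
    \<comment> \<open>With all digits equal to 1 the series is 1/3, which keeps \<open>f\<close>
      below 1.\<close>
    have "f x \<le> (\<Sum>n. 1/4 * (1/4)^n)" for x
      unfolding f_def by (intro suminf_le sm) (auto simp: summable_geometric)
    also have "(\<Sum>n. 1/4 * (1/4)^n) = (1/3::real)"
      by (subst suminf_mult) (auto simp: summable_geometric suminf_geometric)
    finally have "f x \<le> 1/3" for x .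
    then show "f x < 1" for x using le_less_trans[of "f x" "1/3" 1] by simp
  qed
qed

section \<open>Densities and coordinate pairs of product measures\<close>

text \<open>Both measures agree on measurable boxes, where the integral of a product factors over
  the coordinates, and a product of sigma-finite measures is determined by its boxes.
  Sigma-finiteness of the factors is a separate assumption since a density with infinite values can
  destroy it.\<close>

lemma (in product_sigma_finite) density_PiM:
  fixes g :: "'i \<Rightarrow> 'a \<Rightarrow> ennreal"
  assumes I: "finite I" and g[measurable]: "\<And>i. i \<in> I \<Longrightarrow> g i \<in> borel_measurable (M i)"
    and fin: "\<And>i. sigma_finite_measure (density (M i) (g i))"
  shows "density (PiM I M) (\<lambda>x. \<Prod>i\<in>I. g i (x i)) = PiM I (\<lambda>i. density (M i) (g i))"
proof -
  interpret D: product_sigma_finite "\<lambda>i. density (M i) (g i)"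
    using fin by (rule product_sigma_finite.intro)
  show ?thesis
  proof (rule D.PiM_eqI[OF I])
    show "sets (density (PiM I M) (\<lambda>x. \<Prod>i\<in>I. g i (x i))) = sets (PiM I (\<lambda>i. density (M i) (g i)))"
      by (simp cong: sets_PiM_cong)
    fix A assume "\<And>i. i \<in> I \<Longrightarrow> A i \<in> sets (density (M i) (g i))"
    then have A[measurable]: "\<And>i. i \<in> I \<Longrightarrow> A i \<in> sets (M i)" by simp
    have "emeasure (density (PiM I M) (\<lambda>x. \<Prod>i\<in>I. g i (x i))) (PiE I A) =
      (\<integral>\<^sup>+x. (\<Prod>i\<in>I. g i (x i)) * indicator (PiE I A) x \<partial>PiM I M)"
      using I by (intro emeasure_density) (auto intro!: sets_PiM_I_finite)
    also have "\<dots> = (\<integral>\<^sup>+x. (\<Prod>i\<in>I. g i (x i) * indicator (A i) (x i)) \<partial>PiM I M)"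
    proof (rule nn_integral_cong)
      fix x assume "x \<in> space (PiM I M)"
      then have x: "x \<in> extensional I" by (auto simp: space_PiM PiE_def)
      have "(indicator (PiE I A) x :: ennreal) = (\<Prod>i\<in>I. indicator (A i) (x i))"
        using I x by (cases "x \<in> PiE I A")
         (auto simp: PiE_def Pi_iff prod_zero_iff indicator_def)
      then show "(\<Prod>i\<in>I. g i (x i)) * indicator (PiE I A) x = (\<Prod>i\<in>I. g i (x i) * indicator (A i) (x i))"
        by (simp add: prod.distrib)
    qed
    also have "\<dots> = (\<Prod>i\<in>I. \<integral>\<^sup>+x. g i x * indicator (A i) x \<partial>M i)"
      using I by (intro product_nn_integral_prod) auto
    also have "\<dots> = (\<Prod>i\<in>I. emeasure (density (M i) (g i)) (A i))"
      by (intro prod.cong refl) (simp add: emeasure_density)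
    finally show "emeasure (density (PiM I M) (\<lambda>x. \<Prod>i\<in>I. g i (x i))) (PiE I A) =
      (\<Prod>i\<in>I. emeasure (density (M i) (g i)) (A i))" .
  qed
qed

text \<open>The preimage of a rectangle is a box whose sides are the whole space outside
  \<open>i\<close> and \<open>j\<close>. Those sides have mass 1, so only the two chosen factors
  remain.\<close>

lemma (in prob_space) distr_PiM_pair:
  assumes I: "finite I" "i \<in> I" "j \<in> I" "i \<noteq> j"
  shows "distr (PiM I (\<lambda>_. M)) (M \<Otimes>\<^sub>M M) (\<lambda>x. (x i, x j)) = M \<Otimes>\<^sub>M M"
proof (rule sym, rule pair_measure_eqI)
  interpret P: product_sigma_finite "\<lambda>_::'b. M" by standard
  fix A B assume [measurable]: "A \<in> sets M" "B \<in> sets M"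
  have "(\<lambda>x. (x i, x j)) -` (A \<times> B) \<inter> space (PiM I (\<lambda>_. M)) =
    PiE I (\<lambda>k. if k = i then A else if k = j then B else space M)"
    using I sets.sets_into_space[of A M] sets.sets_into_space[of B M]
    by (auto simp: space_PiM PiE_iff split: if_splits) blast
  moreover have "(\<Prod>k\<in>I. emeasure M (if k = i then A else if k = j then B else space M)) =
     (\<Prod>k\<in>{i, j}. emeasure M (if k = i then A else if k = j then B else space M))"
    using I by (intro prod.mono_neutral_right) (auto simp: emeasure_space_1)
  ultimately show "emeasure M A * emeasure M B =
      emeasure (distr (PiM I (\<lambda>_. M)) (M \<Otimes>\<^sub>M M) (\<lambda>x. (x i, x j))) (A \<times> B)"
    using I by (simp add: emeasure_distr P.emeasure_PiM)
qed (auto intro: sigma_finite_measure_axioms)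

section \<open>Ranking losses of a pair of independent inputs\<close>

text \<open>Here \<open>N\<close> stands for the law of an input and \<open>r\<close> for its
  conditional risk. The bound \<open>L\<close> makes all integrands below bounded, hence
  integrable.\<close>

locale pairwise_ranking = prob_space N for N :: "'x measure" +
  fixes r :: "'x \<Rightarrow> real" and L :: real
  assumes diagonal: "{w \<in> space (N \<Otimes>\<^sub>M N). fst w = snd w} \<in> sets (N \<Otimes>\<^sub>M N)"
    and r_measurable[measurable]: "r \<in> borel_measurable N"
    and r_nonneg: "x \<in> space N \<Longrightarrow> 0 \<le> r x"
    and r_le: "x \<in> space N \<Longrightarrow> r x \<le> L"
begin

sublocale NN: pair_prob_space N N ..

text \<open>Both orientations of the equation are declared because both occur in the integrands
  below.\<close>

lemma diagonal_measurable[measurable]: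
  "Measurable.pred (N \<Otimes>\<^sub>M N) (\<lambda>w. fst w = snd w)"
  "Measurable.pred (N \<Otimes>\<^sub>M N) (\<lambda>w. snd w = fst w)"
proof -
  show *: "Measurable.pred (N \<Otimes>\<^sub>M N) (\<lambda>w. fst w = snd w)"
    using diagonal by (simp add: pred_def)
  have "(\<lambda>w. snd w = fst w) = (\<lambda>w :: 'x \<times> 'x. fst w = snd w)" by auto
  with * show "Measurable.pred (N \<Otimes>\<^sub>M N) (\<lambda>w. snd w = fst w)" by simp
qed

text \<open>The expectation of one term of the SELE loss with distinct indices, after its label has
  been averaged out.\<close>

definition pair_risk :: "('x \<Rightarrow> real) \<Rightarrow> real" where
  "pair_risk s = (LINT w|(N \<Otimes>\<^sub>M N). r (fst w) * of_bool (s (fst w) \<le> s (snd w)))"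

text \<open>Together with \<open>inversion_loss\<close>, these are the two integrals of the theorem,
  written over the product measure instead of iterated.\<close>

definition tie_loss :: "('x \<Rightarrow> real) \<Rightarrow> real" where
  "tie_loss s = (LINT w|(N \<Otimes>\<^sub>M N). max (r (fst w)) (r (snd w)) *
     of_bool (snd w \<noteq> fst w \<and> s (snd w) = s (fst w)))"

definition inversion_loss :: "('x \<Rightarrow> real) \<Rightarrow> real" where
  "inversion_loss s = (LINT w|(N \<Otimes>\<^sub>M N). (r (fst w) - r (snd w)) *
     of_bool (r (snd w) < r (fst w) \<and> s (snd w) > s (fst w)))"

text \<open>What every score pays when the two orders of a pair are added: the smaller risk always,
  and on the diagonal the risk a second time, since a point is always tied with itself.\<close>

definition unavoidable_loss :: real where
  "unavoidable_loss = (LINT w|(N \<Otimes>\<^sub>M N). min (r (fst w)) (r (snd w)) + r (fst w) * of_bool (fst w = snd w))"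

lemma integrable_pair:
  assumes "f \<in> borel_measurable (N \<Otimes>\<^sub>M N)"
    and "\<And>x z. x \<in> space N \<Longrightarrow> z \<in> space N \<Longrightarrow> \<bar>f (x, z)\<bar> \<le> (c::real)"
  shows "integrable (N \<Otimes>\<^sub>M N) f"
  using assms by (intro NN.P.integrable_const_bound[of _ c]) (auto simp: space_pair_measure)

lemma integrable_losses:
  fixes s :: "'x \<Rightarrow> real"
  assumes [measurable]: "s \<in> borel_measurable N"
  shows "integrable (N \<Otimes>\<^sub>M N) (\<lambda>w. r (fst w) * of_bool (s (fst w) \<le> s (snd w)))"
    and "integrable (N \<Otimes>\<^sub>M N) (\<lambda>w. r (snd w) * of_bool (s (snd w) \<le> s (fst w)))"
    and "integrable (N \<Otimes>\<^sub>M N) (\<lambda>w. max (r (fst w)) (r (snd w)) *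
       of_bool (snd w \<noteq> fst w \<and> s (snd w) = s (fst w)))"
    and "integrable (N \<Otimes>\<^sub>M N) (\<lambda>w. (r (fst w) - r (snd w)) *
       of_bool (r (snd w) < r (fst w) \<and> s (snd w) > s (fst w)))"
    and "integrable (N \<Otimes>\<^sub>M N) (\<lambda>w. (r (snd w) - r (fst w)) *
       of_bool (r (fst w) < r (snd w) \<and> s (fst w) > s (snd w)))"
    and "integrable (N \<Otimes>\<^sub>M N) (\<lambda>w. min (r (fst w)) (r (snd w)) + r (fst w) * of_bool (fst w = snd w))"
proof -
  have *: "0 \<le> r x" "r x \<le> L" "0 \<le> L" if "x \<in> space N" for x
    using r_nonneg[OF that] r_le[OF that] by auto
  show "integrable (N \<Otimes>\<^sub>M N) (\<lambda>w. r (fst w) * of_bool (s (fst w) \<le> s (snd w)))"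
  proof (rule integrable_pair[of _ L], goal_cases)
    case 1
    show ?case by measurable
  next
    case (2 x z)
    with *[of x] *[of z] show ?case by (auto simp: of_bool_def max_def min_def)
  qed
  show "integrable (N \<Otimes>\<^sub>M N) (\<lambda>w. r (snd w) * of_bool (s (snd w) \<le> s (fst w)))"
  proof (rule integrable_pair[of _ L], goal_cases)
    case 1
    show ?case by measurable
  next
    case (2 x z)
    with *[of x] *[of z] show ?case by (auto simp: of_bool_def max_def min_def)
  qed
  show "integrable (N \<Otimes>\<^sub>M N) (\<lambda>w. max (r (fst w)) (r (snd w)) *
       of_bool (snd w \<noteq> fst w \<and> s (snd w) = s (fst w)))"
  proof (rule integrable_pair[of _ L], goal_cases)
    case 1
    show ?case by measurable
  next
    case (2 x z)
    with *[of x] *[of z] show ?case by (auto simp: of_bool_def max_def min_def)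
  qed
  show "integrable (N \<Otimes>\<^sub>M N) (\<lambda>w. (r (fst w) - r (snd w)) *
       of_bool (r (snd w) < r (fst w) \<and> s (snd w) > s (fst w)))"
  proof (rule integrable_pair[of _ L], goal_cases)
    case 1
    show ?case by measurable
  next
    case (2 x z)
    with *[of x] *[of z] show ?case by (auto simp: of_bool_def max_def min_def)
  qed
  show "integrable (N \<Otimes>\<^sub>M N) (\<lambda>w. (r (snd w) - r (fst w)) *
       of_bool (r (fst w) < r (snd w) \<and> s (fst w) > s (snd w)))"
  proof (rule integrable_pair[of _ L], goal_cases)
    case 1
    show ?case by measurable
  next
    case (2 x z)
    with *[of x] *[of z] show ?case by (auto simp: of_bool_def max_def min_def)
  qed
  show "integrable (N \<Otimes>\<^sub>M N) (\<lambda>w. min (r (fst w)) (r (snd w)) + r (fst w) * of_bool (fst w = snd w))"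
  \<comment> \<open>The integrand is a sum of two terms, each at most \<open>L\<close>.\<close>
  proof (rule integrable_pair[of _ "2 * L"], goal_cases)
    case 1
    show ?case by measurable
  next
    case (2 x z)
    with *[of x] *[of z] show ?case by (auto simp: of_bool_def max_def min_def)
  qed
qed

lemma integral_swap:
  fixes f :: "'x \<Rightarrow> 'x \<Rightarrow> real"
  assumes [measurable]: "(\<lambda>w. f (fst w) (snd w)) \<in> borel_measurable (N \<Otimes>\<^sub>M N)"
  shows "(LINT w|(N \<Otimes>\<^sub>M N). f (snd w) (fst w)) = (LINT w|(N \<Otimes>\<^sub>M N). f (fst w) (snd w))"
  using NN.integral_product_swap[OF assms] by (simp add: case_prod_beta')

text \<open>Adding the two orders of a pair leaves a pointwise identity. If the scores differ, the
  risk of the lower scored point is paid: the minimum, plus the gap if the pair is inverted. If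
  distinct points are tied, both risks are paid, which is the minimum plus the maximum. On the
  diagonal the risk is paid twice.\<close>

lemma pair_risk_decomposition:
  assumes s[measurable]: "s \<in> borel_measurable N"
  shows "2 * pair_risk s = unavoidable_loss + tie_loss s + 2 * inversion_loss s"
proof -
  note i = integrable_losses[OF s]
  have "2 * pair_risk s = (LINT w|(N \<Otimes>\<^sub>M N). r (fst w) * of_bool (s (fst w) \<le> s (snd w)))
     + (LINT w|(N \<Otimes>\<^sub>M N). r (snd w) * of_bool (s (snd w) \<le> s (fst w)))"
    by (subst integral_swap[of "\<lambda>x z. r x * of_bool (s x \<le> s z)"]) (auto simp: pair_risk_def)
  also have "\<dots> = (LINT w|(N \<Otimes>\<^sub>M N). r (fst w) * of_bool (s (fst w) \<le> s (snd w)) +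
     r (snd w) * of_bool (s (snd w) \<le> s (fst w)))"
    using i(1,2) by simp
  also have "\<dots> = (LINT w|(N \<Otimes>\<^sub>M N). ((min (r (fst w)) (r (snd w)) + r (fst w) * of_bool (fst w = snd w))
     + max (r (fst w)) (r (snd w)) * of_bool (snd w \<noteq> fst w \<and> s (snd w) = s (fst w)))
     + ((r (fst w) - r (snd w)) * of_bool (r (snd w) < r (fst w) \<and> s (snd w) > s (fst w))
     + (r (snd w) - r (fst w)) * of_bool (r (fst w) < r (snd w) \<and> s (fst w) > s (snd w))))"
    by (intro Bochner_Integration.integral_cong refl) (auto simp: of_bool_def min_def max_def)
  also have "\<dots> = unavoidable_loss + tie_loss s + (inversion_loss s +
     (LINT w|(N \<Otimes>\<^sub>M N). (r (snd w) - r (fst w)) * of_bool (r (fst w) < r (snd w) \<and> s (fst w) > s (snd w))))"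
    using i(3-6) by (simp add: unavoidable_loss_def tie_loss_def inversion_loss_def)
  \<comment> \<open>Exchanging the points turns the other orientation of an inversion into the
    first, whence the factor 2.\<close>
  also have "(LINT w|(N \<Otimes>\<^sub>M N). (r (snd w) - r (fst w)) * of_bool (r (fst w) < r (snd w) \<and> s (fst w) > s (snd w)))
     = inversion_loss s"
    unfolding inversion_loss_def
    by (rule integral_swap[of "\<lambda>x z. (r x - r z) * of_bool (r z < r x \<and> s z > s x)"]) measurable
  finally show ?thesis by simp
qed

lemma tie_loss_nonneg: "0 \<le> tie_loss s"
  unfolding tie_loss_def
  by (intro integral_nonneg_AE AE_I2) (auto simp: space_pair_measure r_nonneg le_max_iff_disj)

lemma inversion_loss_nonneg: "0 \<le> inversion_loss s"
  unfolding inversion_loss_def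
  by (intro integral_nonneg_AE AE_I2) (auto simp: of_bool_def)

text \<open>Ordering by \<open>r\<close> and then by an injective \<open>f\<close> need not be
  realisable by a real score. Rounding \<open>r\<close> to a grid of width \<open>1 / Suc k\<close>
  leaves room for \<open>f\<close> inside each unit step: ties disappear, and inversions occur only
  between risks at most one grid width apart.\<close>

lemma ex_small_losses:
  assumes "e > 0"
  obtains s where "s \<in> borel_measurable N" "tie_loss s = 0" "inversion_loss s < e"
proof -
  obtain f :: "'x \<Rightarrow> real" where [measurable]: "f \<in> borel_measurable N" and
    f: "inj_on f (space N)" "\<And>x. 0 \<le> f x" "\<And>x. f x < 1"
    using ex_inj_on_measurable[OF diagonal] by metis
  obtain k where k: "inverse (real (Suc k)) < e" using reals_Archimedean[OF assms] by auto
  define s where "s x = of_int \<lfloor>real (Suc k) * r x\<rfloor> + f x" for x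
  have [measurable]: "s \<in> borel_measurable N" unfolding s_def by measurable
  \<comment> \<open>Since \<open>f\<close> takes values in [0, 1), the grid cell can be read off the
    score; equal scores therefore also have equal values of \<open>f\<close>.\<close>
  have floor_s: "\<lfloor>s x\<rfloor> = \<lfloor>real (Suc k) * r x\<rfloor>" for x
    unfolding s_def using f(2,3)[of x] by (intro floor_unique) auto
  show thesis
  proof
    have "z = x" if "s z = s x" "x \<in> space N" "z \<in> space N" for x z
    proof -
      have "f z = f x" using that(1) floor_s[of x] floor_s[of z] by (simp add: s_def)
      then show "z = x" using f(1) that by (auto dest: inj_onD)
    qed
    then have "tie_loss s = (LINT w|(N \<Otimes>\<^sub>M N). 0)"
      unfolding tie_loss_def by (intro Bochner_Integration.integral_cong refl) (auto simp: space_pair_measure)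
    then show "tie_loss s = 0" by simp
    have "inversion_loss s \<le> (LINT w|(N \<Otimes>\<^sub>M N). inverse (real (Suc k)))"
      unfolding inversion_loss_def
    proof (rule integral_mono[OF integrable_losses(4)])
      fix w
      show "(r (fst w) - r (snd w)) * of_bool (r (snd w) < r (fst w) \<and> s (fst w) < s (snd w))
         \<le> inverse (real (Suc k))"
      proof (cases "r (snd w) < r (fst w) \<and> s (fst w) < s (snd w)")
        case True
        \<comment> \<open>An inverted pair cannot have its riskier point in a higher cell, so the
          two scaled risks differ by less than 1.\<close>
        then have "\<lfloor>s (fst w)\<rfloor> \<le> \<lfloor>s (snd w)\<rfloor>" by (intro floor_mono) simp
        then have "real (Suc k) * r (fst w) < real (Suc k) * r (snd w) + 1"
          unfolding floor_s by linarith
        then have "real (Suc k) * (r (fst w) - r (snd w)) \<le> 1" by (simp add: algebra_simps)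
        then show ?thesis using True by (simp add: field_simps)
      next
        case False
        then show ?thesis by (auto simp: of_bool_def)
      qed
    qed auto
    also have "\<dots> = inverse (real (Suc k))" by (simp add: NN.P.prob_space)
    finally show "inversion_loss s < e" using k by simp
  qed measurable
qed

text \<open>By the decomposition, minimising \<open>pair_risk\<close> means minimising a sum of
  nonnegative losses with infimum 0. The infimum need not be attained, so a minimiser is compared
  with scores of arbitrarily small loss.\<close>

lemma is_arg_min_pair_risk_iff:
  assumes s[measurable]: "s \<in> borel_measurable N"
  shows "is_arg_min pair_risk (\<lambda>s. s \<in> borel_measurable N) s \<longleftrightarrow>
    tie_loss s = 0 \<and> inversion_loss s = 0"
proof
  assume min: "is_arg_min pair_risk (\<lambda>s. s \<in> borel_measurable N) s"
  have "tie_loss s + 2 * inversion_loss s \<le> 0 + e" if "e > 0" for e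
  proof -
    \<comment> \<open>Halving \<open>e\<close> makes up for the factor 2 before
      \<open>inversion_loss\<close>.\<close>
    have "e / 2 > 0" using that by simp
    then obtain t where t: "t \<in> borel_measurable N" "tie_loss t = 0" "inversion_loss t < e / 2"
      using ex_small_losses by blast
    then have "pair_risk s \<le> pair_risk t" using min by (auto simp: is_arg_min_def not_less)
    with t show ?thesis
      using pair_risk_decomposition[OF s] pair_risk_decomposition[OF t(1)] by simp
  qed
  then have "tie_loss s + 2 * inversion_loss s \<le> 0" by (rule field_le_epsilon)
  then show "tie_loss s = 0 \<and> inversion_loss s = 0"
    using tie_loss_nonneg[of s] inversion_loss_nonneg[of s] by simp
next
  assume 0: "tie_loss s = 0 \<and> inversion_loss s = 0"
  have "pair_risk s \<le> pair_risk t" if "t \<in> borel_measurable N" for t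
    using pair_risk_decomposition[OF s] pair_risk_decomposition[OF that] 0
      tie_loss_nonneg[of t] inversion_loss_nonneg[of t] by simp
  then show "is_arg_min pair_risk (\<lambda>s. s \<in> borel_measurable N) s"
    by (auto simp: is_arg_min_def not_less)
qed

end

section \<open>From a sample to pairs of inputs\<close>

lemma sum_diagonal_or_off:
  fixes a b :: real
  shows "(\<Sum>i=1..n. \<Sum>j=1..n. if i = j then a else b) = real n * a + real n * (real n - 1) * b"
proof -
  have "(\<Sum>j=1..n. if i = j then a else b) = a + (real n - 1) * b" if "i \<in> {1..n}" for i
  proof -
    have "(\<Sum>j=1..n. if i = j then a else b) = (\<Sum>j=1..n. b + (if i = j then a - b else 0))"
      by (intro sum.cong) auto
    also have "\<dots> = real n * b + (a - b)" using that by (simp add: sum.distrib)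
    finally show ?thesis by (simp add: algebra_simps)
  qed
  then have "(\<Sum>i=1..n. \<Sum>j=1..n. if i = j then a else b) = (\<Sum>i=1..n. a + (real n - 1) * b)"
    by (intro sum.cong refl)
  then show ?thesis by (simp add: algebra_simps)
qed

text \<open>For \<open>i = j\<close> the comparison is always true and the law of one coordinate is
  \<open>N\<close>; for distinct indices the two coordinates have law
  \<open>N \<Otimes>\<^sub>M N\<close>. It remains to count the terms of each kind.\<close>

lemma (in pairwise_ranking) expected_pairwise_loss:
  assumes s[measurable]: "s \<in> borel_measurable N"
  shows "(LINT x|PiM {1..n} (\<lambda>_. N).
      (\<Sum>i=1..n. \<Sum>j=1..n. r (x i) * of_bool (s (x i) \<le> s (x j)))) =
    real n * expectation r + real n * (real n - 1) * pair_risk s"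
proof -
  interpret P: prob_space "PiM {1..n} (\<lambda>_. N)" by (intro prob_space_PiM prob_space_axioms)
  let ?t = "\<lambda>i j x. r (x i) * of_bool (s (x i) \<le> s (x j))"
  have t: "integrable (PiM {1..n} (\<lambda>_. N)) (?t i j) \<and>
      (LINT x|PiM {1..n} (\<lambda>_. N). ?t i j x) = (if i = j then expectation r else pair_risk s)"
    if ij: "i \<in> {1..n}" "j \<in> {1..n}" for i j
  proof
    have t_pair: "(\<lambda>w. r (fst w) * of_bool (s (fst w) \<le> s (snd w))) \<in> borel_measurable (N \<Otimes>\<^sub>M N)"
      by measurable
    have pair: "(\<lambda>x. (x i, x j)) \<in> PiM {1..n} (\<lambda>_. N) \<rightarrow>\<^sub>M N \<Otimes>\<^sub>M N"
      using ij by measurable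
    have *: "\<bar>r y\<bar> \<le> L" if "y \<in> space N" for y
      using r_nonneg[OF that] r_le[OF that] by auto
    show "integrable (PiM {1..n} (\<lambda>_. N)) (?t i j)"
    proof (rule P.integrable_const_bound[of _ L])
      show "AE x in PiM {1..n} (\<lambda>_. N). norm (?t i j x) \<le> L"
      proof (rule AE_I2)
        fix x assume "x \<in> space (PiM {1..n} (\<lambda>_. N))"
        then have "\<bar>r (x i)\<bar> \<le> L" using ij by (intro * ) (auto simp: space_PiM)
        then show "norm (?t i j x) \<le> L" by (auto simp: of_bool_def)
      qed
      show "?t i j \<in> borel_measurable (PiM {1..n} (\<lambda>_. N))"
        using measurable_compose[OF pair t_pair] by simp
    qed
    show "(LINT x|PiM {1..n} (\<lambda>_. N). ?t i j x) = (if i = j then expectation r else pair_risk s)"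
    proof (cases "i = j")
      case True
      have "(LINT x|PiM {1..n} (\<lambda>_. N). ?t i j x) = (LINT y|distr (PiM {1..n} (\<lambda>_. N)) N (\<lambda>x. x i). r y)"
        using True ij by (subst integral_distr) simp_all
      also have "distr (PiM {1..n} (\<lambda>_. N)) N (\<lambda>x. x i) = N"
        using ij by (intro distr_PiM_component prob_space_axioms) auto
      finally show ?thesis using True by simp
    next
      case False
      have "pair_risk s = (LINT w|distr (PiM {1..n} (\<lambda>_. N)) (N \<Otimes>\<^sub>M N) (\<lambda>x. (x i, x j)).
         r (fst w) * of_bool (s (fst w) \<le> s (snd w)))"
        using ij False by (subst distr_PiM_pair) (auto simp: pair_risk_def)
      also have "\<dots> = (LINT x|PiM {1..n} (\<lambda>_. N). ?t i j x)"
        by (subst integral_distr[OF pair t_pair]) simp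
      finally show ?thesis using False by simp
    qed
  qed
  have "(LINT x|PiM {1..n} (\<lambda>_. N). (\<Sum>i=1..n. \<Sum>j=1..n. ?t i j x)) =
      (\<Sum>i=1..n. LINT x|PiM {1..n} (\<lambda>_. N). (\<Sum>j=1..n. ?t i j x))"
    using t by (intro Bochner_Integration.integral_sum Bochner_Integration.integrable_sum) auto
  also have "\<dots> = (\<Sum>i=1..n. \<Sum>j=1..n. LINT x|PiM {1..n} (\<lambda>_. N). ?t i j x)"
    using t by (intro sum.cong refl Bochner_Integration.integral_sum) auto
  also have "\<dots> = (\<Sum>i=1..n. \<Sum>j=1..n. if i = j then expectation r else pair_risk s)"
    using t by (intro sum.cong refl) auto
  finally show ?thesis by (simp only: sum_diagonal_or_off)
qed

section \<open>Iterated integrals against a density\<close>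

text \<open>Fubini on the product of the weighted measures, after which each of the two integrals
  turns its density into a factor. This links the losses over the product measure with the double
  integrals of the theorem.\<close>

lemma iterated_integral_density:
  fixes f :: "'a \<times> 'a \<Rightarrow> real"
  assumes m[measurable]: "m \<in> borel_measurable M" and m0: "\<And>x. x \<in> space M \<Longrightarrow> 0 \<le> m x"
    and sf: "sigma_finite_measure (density M (\<lambda>x. ennreal (m x)))" (is "sigma_finite_measure ?N")
    and int: "integrable (density M m \<Otimes>\<^sub>M density M m) f"
  shows "(LINT x|M. LINT z|M. f (x, z) * m x * m z) = (LINT w|(density M m \<Otimes>\<^sub>M density M m). f w)"
proof -
  interpret N: sigma_finite_measure ?N by (rule sf)
  interpret NN: pair_sigma_finite ?N ?N using sf by (simp add: pair_sigma_finite_def)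
  have "f \<in> borel_measurable (?N \<Otimes>\<^sub>M ?N)" using int by auto
  moreover have "sets (?N \<Otimes>\<^sub>M ?N) = sets (M \<Otimes>\<^sub>M M)" by (intro sets_pair_measure_cong) simp_all
  ultimately have f[measurable]: "f \<in> borel_measurable (M \<Otimes>\<^sub>M M)"
    using measurable_cong_sets by blast
  have in_dens: "(LINT z|?N. g z) = (LINT z|M. m z * g z)" if "g \<in> borel_measurable M" for g :: "'a \<Rightarrow> real"
    using that by (subst integral_density) (auto simp: m0)
  have [measurable]: "(\<lambda>x. LINT z|?N. f (x, z)) \<in> borel_measurable M"
  proof -
    have "(\<lambda>x. LINT z|?N. f (x, z)) \<in> borel_measurable ?N"
      using int by (intro N.borel_measurable_lebesgue_integral) simp
    then show ?thesis by simp
  qed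
  have "(LINT w|(?N \<Otimes>\<^sub>M ?N). f w) = (LINT x|?N. LINT z|?N. f (x, z))"
    using NN.integral_fst'[OF int] by simp
  also have "\<dots> = (LINT x|M. m x * (LINT z|?N. f (x, z)))"
    by (rule in_dens) measurable
  also have "\<dots> = (LINT x|M. LINT z|M. f (x, z) * m x * m z)"
  proof (rule Bochner_Integration.integral_cong[OF refl])
    fix x assume "x \<in> space M"
    then have "(\<lambda>z. f (x, z)) \<in> borel_measurable M" by measurable
    then have "m x * (LINT z|?N. f (x, z)) = m x * (LINT z|M. m z * f (x, z))"
      by (subst in_dens) auto
    also have "\<dots> = (LINT z|M. m x * (m z * f (x, z)))" by simp
    finally show "m x * (LINT z|?N. f (x, z)) = (LINT z|M. f (x, z) * m x * m z)"
      by (simp add: mult_ac)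
  qed
  finally show ?thesis by simp
qed

section \<open>Averaging out the labels\<close>

lemma cond_risk_measurable:
  assumes "cond_distribution M p q" and h[measurable]: "h \<in> measurable M (count_space UNIV)"
  shows "cond_risk q l h \<in> borel_measurable M"
proof -
  have [measurable]: "(\<lambda>x. q x y) \<in> borel_measurable M" for y
    using assms by (simp add: cond_distribution_def)
  have [measurable]: "(\<lambda>x. l y (h x)) \<in> borel_measurable M" for y
    by (rule measurable_compose[OF h]) simp
  show ?thesis unfolding cond_risk_def[abs_def] by measurable
qed

text \<open>Each weight \<open>q x y\<close> is at most 1 and there are finitely many labels, so
  summing the whole loss table gives a crude bound that is uniform in \<open>x\<close>.\<close>

lemma cond_risk_bounds:
  assumes "cond_distribution M p q" "\<And>y y'. 0 \<le> l y y'" "x \<in> space M"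
  shows "0 \<le> cond_risk q l h x" "cond_risk q l h x \<le> (\<Sum>y\<in>UNIV. \<Sum>y'\<in>UNIV. l y y')"
proof -
  have q: "0 \<le> q x y" "(\<Sum>y\<in>UNIV. q x y) = 1" for y
    using assms by (auto simp: cond_distribution_def)
  then have "q x y \<le> 1" for y using member_le_sum[of y UNIV "q x"] by simp
  then show "0 \<le> cond_risk q l h x" "cond_risk q l h x \<le> (\<Sum>y\<in>UNIV. \<Sum>y'\<in>UNIV. l y y')"
    unfolding cond_risk_def using q assms(2)
    by (auto intro!: sum_nonneg sum_mono order_trans[OF mult_left_le_one_le member_le_sum])
qed

lemma sum_mult_loss_eq_cond_risk:
  assumes "cond_distribution M p q" "x \<in> space M"
  shows "(\<Sum>y\<in>UNIV. p (x, y) * l y (h x)) = marginal p x * cond_risk q l h x"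
proof -
  have "p (x, y) = marginal p x * q x y" for y
    using assms by (auto simp: cond_distribution_def)
  then show ?thesis by (simp only: cond_risk_def sum_distrib_left mult.assoc)
qed

text \<open>For fixed inputs, a term of the loss involves a single label. Distributivity factors the
  sum over label vectors: the other labels sum to marginals, and label \<open>i\<close> yields the
  marginal times the conditional risk.\<close>

lemma sum_prod_mult_sele_loss:
  assumes q: "cond_distribution M p q" and x: "\<And>i. i \<in> {1..n} \<Longrightarrow> x i \<in> space M"
  shows "(\<Sum>y\<in>PiE {1..n} (\<lambda>_. UNIV). (\<Prod>i=1..n. p (x i, y i)) * sele_loss l h n s (\<lambda>i. (x i, y i))) =
    (\<Prod>i=1..n. marginal p (x i)) * (1 / (real n)\<^sup>2 *
      (\<Sum>i=1..n. \<Sum>j=1..n. cond_risk q l h (x i) * of_bool (s (x i) \<le> s (x j))))"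
proof -
  let ?Y = "PiE {1..n} (\<lambda>_. UNIV)"
  have key: "(\<Sum>y\<in>?Y. (\<Prod>k=1..n. p (x k, y k)) * l (y i) (h (x i))) =
      (\<Prod>k=1..n. marginal p (x k)) * cond_risk q l h (x i)" if i: "i \<in> {1..n}" for i
  proof -
    \<comment> \<open>The loss is absorbed into the factor at \<open>i\<close>, so that the summand
      becomes a pure product over the coordinates.\<close>
    let ?g = "\<lambda>k y. p (x k, y) * (if k = i then l y (h (x k)) else 1)"
    have "(\<Sum>y\<in>?Y. (\<Prod>k=1..n. p (x k, y k)) * l (y i) (h (x i))) = (\<Sum>y\<in>?Y. \<Prod>k=1..n. ?g k (y k))"
      using i by (intro sum.cong refl) (simp add: prod.distrib)
    also have "\<dots> = (\<Prod>k=1..n. \<Sum>y\<in>UNIV. ?g k y)" by (rule prod_sum_PiE[symmetric]) auto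
    also have "\<dots> = (\<Prod>k=1..n. marginal p (x k) * (if k = i then cond_risk q l h (x k) else 1))"
      using sum_mult_loss_eq_cond_risk[OF q x] by (intro prod.cong refl) (auto simp: marginal_def)
    also have "\<dots> = (\<Prod>k=1..n. marginal p (x k)) * cond_risk q l h (x i)"
      using i by (simp add: prod.distrib)
    finally show ?thesis .
  qed
  have "(\<Sum>y\<in>?Y. (\<Prod>i=1..n. p (x i, y i)) * sele_loss l h n s (\<lambda>i. (x i, y i))) =
    (\<Sum>y\<in>?Y. \<Sum>i=1..n. \<Sum>j=1..n. 1 / (real n)\<^sup>2 * of_bool (s (x i) \<le> s (x j)) *
      ((\<Prod>k=1..n. p (x k, y k)) * l (y i) (h (x i))))"
    by (simp only: sele_loss_def fst_conv snd_conv sum_distrib_left mult_ac)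
  also have "\<dots> = (\<Sum>i=1..n. \<Sum>j=1..n. \<Sum>y\<in>?Y. 1 / (real n)\<^sup>2 * of_bool (s (x i) \<le> s (x j)) *
      ((\<Prod>k=1..n. p (x k, y k)) * l (y i) (h (x i))))"
    by (subst sum.swap, intro sum.cong refl, rule sum.swap)
  also have "\<dots> = (\<Sum>i=1..n. \<Sum>j=1..n. 1 / (real n)\<^sup>2 * of_bool (s (x i) \<le> s (x j)) *
      ((\<Prod>k=1..n. marginal p (x k)) * cond_risk q l h (x i)))"
    by (intro sum.cong refl) (simp only: sum_distrib_left[symmetric] key)
  also have "\<dots> = (\<Prod>i=1..n. marginal p (x i)) * (1 / (real n)\<^sup>2 *
      (\<Sum>i=1..n. \<Sum>j=1..n. cond_risk q l h (x i) * of_bool (s (x i) \<le> s (x j))))"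
    by (simp only: sum_distrib_left mult_ac)
  finally show ?thesis .
qed

lemma marginal_measurable:
  fixes p :: "'x \<times> 'y::finite \<Rightarrow> real"
  assumes [measurable]: "p \<in> borel_measurable (M \<Otimes>\<^sub>M count_space UNIV)"
  shows "marginal p \<in> borel_measurable M"
  unfolding marginal_def[abs_def] by measurable

text \<open>Summing over labels is integration against the counting measure, so Tonelli identifies
  the total mass with that of the joint density.\<close>

lemma prob_space_density_marginal:
  fixes p :: "'x \<times> 'y::finite \<Rightarrow> real"
  assumes p[measurable]: "p \<in> borel_measurable (M \<Otimes>\<^sub>M count_space UNIV)"
    and p0: "\<And>x y. x \<in> space M \<Longrightarrow> 0 \<le> p (x, y)"
    and P: "prob_space (density (M \<Otimes>\<^sub>M count_space UNIV) (\<lambda>w. ennreal (p w)))"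
  shows "prob_space (density M (\<lambda>x. ennreal (marginal p x)))"
proof
  interpret C: sigma_finite_measure "count_space (UNIV :: 'y set)"
    by (rule sigma_finite_measure_count_space)
  have [measurable]: "marginal p \<in> borel_measurable M" by (rule marginal_measurable[OF p])
  have "(\<integral>\<^sup>+x. ennreal (marginal p x) \<partial>M) = (\<integral>\<^sup>+x. \<integral>\<^sup>+y. ennreal (p (x, y)) \<partial>count_space UNIV \<partial>M)"
    by (intro nn_integral_cong) (simp add: marginal_def nn_integral_count_space_finite p0 sum_ennreal)
  also have "\<dots> = (\<integral>\<^sup>+w. ennreal (p w) \<partial>(M \<Otimes>\<^sub>M count_space UNIV))"
    by (rule C.nn_integral_fst) measurable
  also have "\<dots> = 1"
    using prob_space.emeasure_space_1[OF P] by (simp add: emeasure_density cong: nn_integral_cong)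
  finally show "emeasure (density M (\<lambda>x. ennreal (marginal p x))) (space (density M (\<lambda>x. ennreal (marginal p x)))) = 1"
    by (simp add: emeasure_density cong: nn_integral_cong)
qed

text \<open>Once the labels are summed out, the remaining product of marginals is the density of the
  law of the \<open>n\<close> independent inputs.\<close>

lemma E_sele_eq_integral_density:
  fixes p :: "'x \<times> 'y::finite \<Rightarrow> real" and s :: "'x \<Rightarrow> real"
  assumes M: "sigma_finite_measure M"
    and p[measurable]: "p \<in> borel_measurable (M \<Otimes>\<^sub>M count_space UNIV)"
    and p0: "\<And>x y. x \<in> space M \<Longrightarrow> 0 \<le> p (x, y)"
    and P: "prob_space (density (M \<Otimes>\<^sub>M count_space UNIV) (\<lambda>w. ennreal (p w)))"
    and q: "cond_distribution M p q" and h: "h \<in> measurable M (count_space UNIV)"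
    and s[measurable]: "s \<in> borel_measurable M"
  shows "E_sele M p l h n s = 1 / (real n)\<^sup>2 *
    (LINT x|PiM {1..n} (\<lambda>_. density M (\<lambda>x. ennreal (marginal p x))).
      (\<Sum>i=1..n. \<Sum>j=1..n. cond_risk q l h (x i) * of_bool (s (x i) \<le> s (x j))))"
proof -
  interpret MM: product_sigma_finite "\<lambda>_ :: nat. M" using M by (rule product_sigma_finite.intro)
  define m where "m = marginal p"
  have [measurable]: "m \<in> borel_measurable M" unfolding m_def by (rule marginal_measurable[OF p])
  have m0: "0 \<le> m x" if "x \<in> space M" for x
    unfolding m_def marginal_def using that by (intro sum_nonneg p0)
  define r where "r = cond_risk q l h"
  have [measurable]: "r \<in> borel_measurable M" unfolding r_def by (rule cond_risk_measurable[OF q h])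
  let ?P = "PiM {1..n} (\<lambda>_. M)" and ?N = "density M (\<lambda>x. ennreal (m x))"
  let ?F = "\<lambda>x. \<Sum>i=1..n. \<Sum>j=1..n. r (x i) * of_bool (s (x i) \<le> s (x j))"
  have F: "?F \<in> borel_measurable ?P"
  proof (intro borel_measurable_sum)
    fix i j assume ij: "i \<in> {1..n}" "j \<in> {1..n}"
    have pair: "(\<lambda>x. (x i, x j)) \<in> ?P \<rightarrow>\<^sub>M M \<Otimes>\<^sub>M M" using ij by measurable
    have "(\<lambda>w. r (fst w) * of_bool (s (fst w) \<le> s (snd w))) \<in> borel_measurable (M \<Otimes>\<^sub>M M)"
      by measurable
    from measurable_compose[OF pair this]
    show "(\<lambda>x. r (x i) * of_bool (s (x i) \<le> s (x j))) \<in> borel_measurable ?P" by simp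
  qed
  have m_prod: "(\<lambda>x. \<Prod>i=1..n. m (x i)) \<in> borel_measurable ?P" by measurable
  interpret N: prob_space ?N unfolding m_def by (rule prob_space_density_marginal[OF p p0 P])
  have "PiM {1..n} (\<lambda>_. ?N) = density ?P (\<lambda>x. \<Prod>i=1..n. ennreal (m (x i)))"
    by (rule MM.density_PiM[symmetric]) (auto intro: N.sigma_finite_measure_axioms)
  also have "\<dots> = density ?P (\<lambda>x. ennreal (\<Prod>i=1..n. m (x i)))"
    by (intro density_cong AE_I2) (auto simp: space_PiM intro!: prod_ennreal m0)
  finally have N: "PiM {1..n} (\<lambda>_. ?N) = density ?P (\<lambda>x. ennreal (\<Prod>i=1..n. m (x i)))" .
  have "E_sele M p l h n s = (LINT x|?P. (\<Prod>i=1..n. m (x i)) * (1 / (real n)\<^sup>2 * ?F x))"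
    unfolding E_sele_def m_def r_def
    by (intro Bochner_Integration.integral_cong refl sum_prod_mult_sele_loss[OF q])
      (auto simp: space_PiM)
  also have "\<dots> = (LINT x|PiM {1..n} (\<lambda>_. ?N). 1 / (real n)\<^sup>2 * ?F x)"
    unfolding N
  proof (subst integral_density)
    show "(\<lambda>x. 1 / (real n)\<^sup>2 * ?F x) \<in> borel_measurable ?P"
      by (intro borel_measurable_times borel_measurable_const F)
    show "AE x in ?P. 0 \<le> (\<Prod>i=1..n. m (x i))"
      by (intro AE_I2 prod_nonneg m0 ballI) (auto simp: space_PiM PiE_iff)
  qed (rule m_prod, simp only: real_scaleR_def)
  finally show ?thesis unfolding m_def r_def by simp
qed

theorem theorem9:
  fixes M :: "'x measure"
    and p :: "'x \<times> 'y::finite \<Rightarrow> real"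
    and q :: "'x \<Rightarrow> 'y \<Rightarrow> real"
    and l :: "'y \<Rightarrow> 'y \<Rightarrow> real"
    and h :: "'x \<Rightarrow> 'y"
    and n :: nat
    and s_opt :: "'x \<Rightarrow> real"
  defines "r \<equiv> cond_risk q l h"
  assumes "sigma_finite_measure M"
    and "{w \<in> space (M \<Otimes>\<^sub>M M). fst w = snd w} \<in> sets (M \<Otimes>\<^sub>M M)"
    and "p \<in> borel_measurable (M \<Otimes>\<^sub>M count_space UNIV)"
    and "\<And>x y. x \<in> space M \<Longrightarrow> 0 \<le> p (x, y)"
    and "prob_space (density (M \<Otimes>\<^sub>M count_space UNIV) (\<lambda>w. ennreal (p w)))"
    and "cond_distribution M p q"
    and "\<And>y y'. 0 \<le> l y y'"
    and "h \<in> measurable M (count_space UNIV)"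
    and "n \<ge> 2"
    and "s_opt \<in> borel_measurable M"
  shows "is_arg_min (E_sele M p l h n) (\<lambda>s. s \<in> borel_measurable M) s_opt \<longleftrightarrow>
     (LINT x|M. LINT z|M. max (r x) (r z) * marginal p x * marginal p z *
         of_bool (z \<noteq> x \<and> s_opt z = s_opt x)) = 0 \<and>
     (LINT x|M. LINT z|M. (r x - r z) * marginal p x * marginal p z *
         of_bool (r z < r x \<and> s_opt z > s_opt x)) = 0"
proof -
  note M = assms(2) and p = assms(4,5,6) and q = assms(7) and l0 = assms(8) and h = assms(9)
    and s_opt = assms(11)
  define m where "m = marginal p"
  have m: "m \<in> borel_measurable M" "\<And>x. x \<in> space M \<Longrightarrow> 0 \<le> m x"
    unfolding m_def marginal_def[abs_def] using p(1,2)
    by (auto intro!: sum_nonneg simp: marginal_measurable[unfolded marginal_def[abs_def]])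
  define N where "N = density M (\<lambda>x. ennreal (m x))"
  have sets_N[measurable_cong, simp]: "sets N = sets M" and space_N[simp]: "space N = space M"
    by (simp_all add: N_def)
  have sets_NN: "sets (N \<Otimes>\<^sub>M N) = sets (M \<Otimes>\<^sub>M M)" by (intro sets_pair_measure_cong) simp_all
  have meas_N: "borel_measurable N = borel_measurable M" by (rule measurable_cong_sets) simp_all
  interpret prob_space N
    unfolding N_def m_def by (rule prob_space_density_marginal[OF p])
  interpret R: pairwise_ranking N r "\<Sum>y\<in>UNIV. \<Sum>y'\<in>UNIV. l y y'"
  proof
    show "{w \<in> space (N \<Otimes>\<^sub>M N). fst w = snd w} \<in> sets (N \<Otimes>\<^sub>M N)"
      using assms(3) by (simp add: sets_NN space_pair_measure)
    show "r \<in> borel_measurable N"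
      unfolding r_def meas_N by (rule cond_risk_measurable[OF q h])
    fix x assume "x \<in> space N"
    then have "x \<in> space M" by simp
    then show "0 \<le> r x" "r x \<le> (\<Sum>y\<in>UNIV. \<Sum>y'\<in>UNIV. l y y')"
      unfolding r_def using cond_risk_bounds[where M = M and p = p and q = q and l = l and x = x, OF q l0] by auto
  qed
  have E: "E_sele M p l h n s = 1 / (real n)\<^sup>2 *
      (real n * expectation r + real n * (real n - 1) * R.pair_risk s)"
    if "s \<in> borel_measurable M" for s
    using E_sele_eq_integral_density[OF M p q h that, where l = l and n = n, folded r_def m_def, folded N_def]
    unfolding R.expected_pairwise_loss[OF that[folded meas_N]] .
  have iter: "(LINT x|M. LINT z|M. f (x, z) * m x * m z) = (LINT w|(N \<Otimes>\<^sub>M N). f w)"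
    if "integrable (N \<Otimes>\<^sub>M N) f" for f :: "'x \<times> 'x \<Rightarrow> real"
    using m sigma_finite_measure_axioms that unfolding N_def by (rule iterated_integral_density)
  have pos: "0 < 1 / (real n)\<^sup>2" "0 < real n * (real n - 1)"
    using \<open>n \<ge> 2\<close> by auto
  have "E_sele M p l h n s < E_sele M p l h n t \<longleftrightarrow> R.pair_risk s < R.pair_risk t"
    if "s \<in> borel_measurable M" "t \<in> borel_measurable M" for s t
    unfolding E[OF that(1)] E[OF that(2)] mult_less_cancel_left_pos[OF pos(1)] add_less_cancel_left
      mult_less_cancel_left_pos[OF pos(2)] ..
  then have "is_arg_min (E_sele M p l h n) (\<lambda>s. s \<in> borel_measurable M) s_opt \<longleftrightarrow>
      is_arg_min R.pair_risk (\<lambda>s. s \<in> borel_measurable N) s_opt"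
    unfolding is_arg_min_def meas_N using s_opt by blast
  also have "\<dots> \<longleftrightarrow> R.tie_loss s_opt = 0 \<and> R.inversion_loss s_opt = 0"
    using s_opt by (intro R.is_arg_min_pair_risk_iff) (simp add: meas_N)
  also have "R.tie_loss s_opt = (LINT x|M. LINT z|M. max (r x) (r z) *
      of_bool (z \<noteq> x \<and> s_opt z = s_opt x) * m x * m z)"
    unfolding R.tie_loss_def using s_opt
    by (subst iter[symmetric]) (auto intro!: R.integrable_losses simp: meas_N)
  also have "R.inversion_loss s_opt = (LINT x|M. LINT z|M. (r x - r z) *
      of_bool (r z < r x \<and> s_opt z > s_opt x) * m x * m z)"
    unfolding R.inversion_loss_def using s_opt
    by (subst iter[symmetric]) (auto intro!: R.integrable_losses simp: meas_N)
  finally show ?thesis by (simp add: m_def mult_ac)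
qed

end
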